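(* A triple $(a,b,c)$ is the first diagonal $(y_{1,0},y_{2,0},y_{3,0})$ of an arithmetic Y-frieze pattern of width $3$ if and only if $(a,b,c)$ is one of $$(1,1,2),(1,2,3),(1,4,5),(2,1,1),(2,3,2),(2,9,5),(3,2,1),(3,8,3),(5,4,1),(5,9,2).$$
   Context: A Y-frieze pattern of width $n$ is an array of rational numbers $y_{i,j}$, $i=0,1,\dots,n+1$, $j\in\mathbb{Z}$, arranged in staggered rows (entry $y_{i,j}$ placed at horizontal position $j+i/2$ in row $i$), such that row $0$ and row $n+1$ consist entirely of $0$'s, no row strictly between them consists entirely of $0$'s, and the Y-diamond rule $WE=(1+N)(1+S)$ holds for every diamond, i.e. $y_{i,j}\,y_{i,j+1}=(1+y_{i-1,j+1})(1+y_{i+1,j})$ for $1\le i\le n$, $j\in\mathbb{Z}$. It is arithmetic if all entries in rows $1,\dots,n$ (its non-zero entries) are positive integers. The first diagonal is $(y_{1,0},y_{2,0},\dots,y_{n,0})$. *)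

theory Defs
  imports Complex_Main
begin

text \<open>
  The array is indexed by row and position: \<open>y i j\<close> is the entry \<open>y\<^sub>i\<^sub>,\<^sub>j\<close>, drawn at horizontal
  position \<open>j + i/2\<close> of row \<open>i\<close>. Hence the diamond with west corner \<open>y i j\<close> has east corner
  \<open>y i (j + 1)\<close>, north corner \<open>y (i - 1) (j + 1)\<close> and south corner \<open>y (i + 1) j\<close>. Only the
  rows \<open>0, \<dots>, n + 1\<close> belong to the pattern; values of \<open>y\<close> in rows beyond \<open>n + 1\<close> are irrelevant.
\<close>

definition Y_frieze_pattern :: "nat \<Rightarrow> (nat \<Rightarrow> int \<Rightarrow> rat) \<Rightarrow> bool" where
  "Y_frieze_pattern n y \<longleftrightarrow>
     (\<forall>j. y 0 j = 0) \<and>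
     (\<forall>j. y (n + 1) j = 0) \<and>
     (\<forall>i\<in>{1..n}. \<exists>j. y i j \<noteq> 0) \<and>
     (\<forall>i\<in>{1..n}. \<forall>j. y i j * y i (j + 1) = (1 + y (i - 1) (j + 1)) * (1 + y (i + 1) j))"

definition arithmetic_Y_frieze_pattern :: "nat \<Rightarrow> (nat \<Rightarrow> int \<Rightarrow> rat) \<Rightarrow> bool" where
  "arithmetic_Y_frieze_pattern n y \<longleftrightarrow>
     Y_frieze_pattern n y \<and> (\<forall>i\<in>{1..n}. \<forall>j. y i j \<in> \<int> \<and> y i j > 0)"

end

theory Submission
  imports Defs
begin

text \<open>
  A pattern of width 3 is determined by nine entries: six, \<open>p\<^sub>0, \<dots>, p\<^sub>5\<close>, in row 1, repeated in
  row 3 by glide symmetry, and three, \<open>q\<^sub>0, q\<^sub>1, q\<^sub>2\<close>, in row 2. The diamond rule reads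
  \<open>p\<^sub>j p\<^sub>j\<^sub>+\<^sub>1 = 1 + q\<^sub>j\<close> and \<open>q\<^sub>j q\<^sub>j\<^sub>+\<^sub>1 = (1 + p\<^sub>j\<^sub>+\<^sub>1) (1 + p\<^sub>j\<^sub>+\<^sub>4)\<close>, with indices modulo 6 and 3. Since
  \<open>(1 + p\<^sub>j) (1 + p\<^sub>j\<^sub>+\<^sub>1) \<le> 2 (q\<^sub>j + 2)\<close> for positive integers, multiplying the rules of row 2 gives
  \<open>(q\<^sub>0 q\<^sub>1 q\<^sub>2)\<^sup>2 \<le> 8 (q\<^sub>0 + 2) (q\<^sub>1 + 2) (q\<^sub>2 + 2)\<close>, so \<open>q\<^sub>0 \<le> 73\<close>. As \<open>p\<^sub>0\<close> and \<open>p\<^sub>4\<close> divide \<open>1 + q\<^sub>0\<close>, a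
  finite search over the first diagonal \<open>(p\<^sub>0, q\<^sub>0, p\<^sub>4)\<close> remains.
\<close>

definition Y_cycle ::
    "'a \<Rightarrow> 'a \<Rightarrow> 'a \<Rightarrow> 'a \<Rightarrow> 'a \<Rightarrow> 'a \<Rightarrow> 'a \<Rightarrow> 'a \<Rightarrow> 'a::comm_ring_1 \<Rightarrow> bool" where
  "Y_cycle p0 p1 p2 p3 p4 p5 q0 q1 q2 \<longleftrightarrow>
     p0 * p1 = 1 + q0 \<and> p1 * p2 = 1 + q1 \<and> p2 * p3 = 1 + q2 \<and>
     p3 * p4 = 1 + q0 \<and> p4 * p5 = 1 + q1 \<and> p5 * p0 = 1 + q2 \<and>
     q0 * q1 = (1 + p1) * (1 + p4) \<and> q1 * q2 = (1 + p2) * (1 + p5) \<and> q2 * q0 = (1 + p3) * (1 + p0)"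

lemma Y_cycle_of_int:
  "Y_cycle (of_int p0 :: 'a::{comm_ring_1,ring_char_0}) (of_int p1) (of_int p2) (of_int p3)
     (of_int p4) (of_int p5) (of_int q0) (of_int q1) (of_int q2)
   \<longleftrightarrow> Y_cycle p0 p1 p2 p3 p4 p5 q0 q1 q2"
  unfolding Y_cycle_def of_int_1[where 'a = 'a, symmetric]
  by (simp only: of_int_add[symmetric] of_int_mult[symmetric] of_int_eq_iff)

text \<open>The product \<open>p5 * p0\<close> mixes rows 3 and 1, so no single diamond yields it.
  Multiplied by \<open>q0 * p4\<close>, the claim becomes a polynomial consequence of five rules;
  this is where the glide symmetry arises.\<close>

lemma closing_row1:
  fixes p0 :: "'a::field"
  assumes "p0 * p1 = 1 + q0" "p3 * p4 = 1 + q0" "p4 * p5 = 1 + q1"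
    and "q0 * q1 = (1 + p1) * (1 + p4)" "q2 * q0 = (1 + p3) * (1 + p0)"
    and "q0 \<noteq> 0" "p4 \<noteq> 0"
  shows "p5 * p0 = 1 + q2"
proof -
  have "q0 * p4 * (p5 * p0) = q0 * p4 * (1 + q2)"
    using assms(1-5) by algebra
  with assms(6,7) show ?thesis by simp
qed

lemma closing_row2:
  fixes p0 :: "'a::field"
  assumes "p0 * p1 = 1 + q0" "p3 * p4 = 1 + q0" "p1 * p2 = 1 + q1" "p4 * p5 = 1 + q1"
    and "q0 * q1 = (1 + p1) * (1 + p4)" "q2 * q0 = (1 + p3) * (1 + p0)"
    and "q0 \<noteq> 0" "p1 \<noteq> 0" "p4 \<noteq> 0"
  shows "q1 * q2 = (1 + p2) * (1 + p5)"
proof -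
  \<comment> \<open>Since \<open>p1 * (1 + p2) = p1 + 1 + q1\<close>, a factor \<open>q0\<close>
    lets the rule for \<open>q0 * q1\<close> split off \<open>1 + p1\<close>. Identity 2 is the
    image under the index shift by 3, and the product of both contains both known row 2
    rules.\<close>
  have 1: "q0 * (p1 * (1 + p2)) = (1 + p1) * (p4 * (1 + p3))"
    using assms(1-5) by algebra
  have 2: "q0 * (p4 * (1 + p5)) = (1 + p4) * (p1 * (1 + p0))"
    using assms(1-5) by algebra
  have "(q0 * (p1 * (1 + p2))) * (q0 * (p4 * (1 + p5)))
      = (p1 * p4) * (((1 + p1) * (1 + p4)) * ((1 + p3) * (1 + p0)))"
    unfolding 1 2 by (simp add: mult_ac)
  also have "\<dots> = (p1 * p4) * ((q0 * q1) * (q2 * q0))"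
    using assms(5,6) by simp
  finally have "(q0 * q0 * p1 * p4) * ((1 + p2) * (1 + p5)) = (q0 * q0 * p1 * p4) * (q1 * q2)"
    by (simp add: mult_ac)
  with assms(7-9) show ?thesis by simp
qed

text \<open>Here \<open>y 3 j\<close> serves as \<open>p\<^sub>j\<^sub>+\<^sub>4\<close>. Six of the
  nine relations are diamonds near the first diagonal; the three others wrap around the cycle and
  come from the closing lemmas.\<close>

lemma Y_cycle_of_arithmetic:
  assumes "arithmetic_Y_frieze_pattern 3 y"
  shows "Y_cycle (y 1 0) (y 1 1) (y 1 2) (y 3 (-1)) (y 3 0) (y 3 1) (y 2 0) (y 2 1) (y 2 (-1))"
proof -
  have rule: "y i j * y i (j + 1) = (1 + y (i - 1) (j + 1)) * (1 + y (i + 1) j)"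
    if "i \<in> {1..3}" for i j
    using assms that by (auto simp: arithmetic_Y_frieze_pattern_def Y_frieze_pattern_def)
  have bd: "y 0 j = 0" "y 4 j = 0" for j
    using assms by (auto simp: arithmetic_Y_frieze_pattern_def Y_frieze_pattern_def eval_nat_numeral)
  have pos: "y i j > 0" if "i \<in> {1..3}" for i j
    using assms that by (auto simp: arithmetic_Y_frieze_pattern_def)
  have nz: "y 2 0 \<noteq> 0" "y 1 1 \<noteq> 0" "y 3 0 \<noteq> 0"
    using pos[of 2 0] pos[of 1 1] pos[of 3 0] by auto
  have r1: "y 1 j * y 1 (j + 1) = 1 + y 2 j" for j
    using rule[of 1 j] bd by (simp add: numeral_2_eq_2)
  have r2: "y 2 j * y 2 (j + 1) = (1 + y 1 (j + 1)) * (1 + y 3 j)" for j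
    using rule[of 2 j] by simp
  have r3: "y 3 j * y 3 (j + 1) = 1 + y 2 (j + 1)" for j
    using rule[of 3 j] bd by simp
  have e: "y 1 0 * y 1 1 = 1 + y 2 0" "y 1 1 * y 1 2 = 1 + y 2 1"
    "y 3 (-1) * y 3 0 = 1 + y 2 0" "y 3 0 * y 3 1 = 1 + y 2 1"
    "y 2 0 * y 2 1 = (1 + y 1 1) * (1 + y 3 0)"
    "y 2 (-1) * y 2 0 = (1 + y 3 (-1)) * (1 + y 1 0)"
    using r1[of 0] r1[of 1] r3[of "-1"] r3[of 0] r2[of 0] r2[of "-1"]
    by (simp_all add: mult.commute)
  have "y 3 1 * y 1 0 = 1 + y 2 (-1)"
    by (rule closing_row1[OF e(1,3-6) nz(1,3)])
  \<comment> \<open>the previous identity with \<open>p\<^sub>j\<^sub>+\<^sub>3\<close> for \<open>p\<^sub>j\<close>\<close>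
  moreover have "y 1 2 * y 3 (-1) = 1 + y 2 (-1)"
    by (rule closing_row1[of "y 3 (-1)" "y 3 0" "y 2 0" "y 1 0" "y 1 1" "y 1 2" "y 2 1"])
      (use e nz in \<open>simp_all add: mult.commute\<close>)
  moreover have "y 2 1 * y 2 (-1) = (1 + y 1 2) * (1 + y 3 1)"
    by (rule closing_row2[OF e(1,3,2,4-6) nz])
  ultimately show ?thesis
    using e by (simp add: Y_cycle_def)
qed

lemma arithmetic_of_Y_cycle:
  fixes p0 :: int
  assumes cyc: "Y_cycle p0 p1 p2 p3 p4 p5 q0 q1 q2"
    and pos: "p0 > 0" "p1 > 0" "p2 > 0" "p3 > 0" "p4 > 0" "p5 > 0" "q0 > 0" "q1 > 0" "q2 > 0"
  shows "\<exists>y. arithmetic_Y_frieze_pattern 3 y \<and>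
    (of_int p0, of_int q0, of_int p4) = (y 1 0, y 2 0, y 3 0)"
proof -
  define p where "p j = [p0, p1, p2, p3, p4, p5] ! nat (j mod 6)" for j :: int
  \<comment> \<open>Row 2 has period 3; doubling the list lets the residue modulo 6 index both
    \<open>p\<close> and \<open>q\<close>.\<close>
  define q where "q j = [q0, q1, q2, q0, q1, q2] ! nat (j mod 6)" for j :: int
  \<comment> \<open>The shift by 4 puts \<open>p4\<close> at position 0 of row 3; the default 0
    supplies rows 0 and 4.\<close>
  define z :: "nat \<Rightarrow> int \<Rightarrow> int" where
    "z i j = (if i = 1 then p j else if i = 2 then q j else if i = 3 then p (j + 4) else 0)" for i j
  define y :: "nat \<Rightarrow> int \<Rightarrow> rat" where "y i j = of_int (z i j)" for i j
  have steps: "p j > 0 \<and> q j > 0 \<and> p j * p (j + 1) = 1 + q j \<and>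
      p (j + 4) * p (j + 5) = 1 + q (j + 1) \<and> q j * q (j + 1) = (1 + p (j + 1)) * (1 + p (j + 4))" for j
  proof -
    have "j mod 6 \<in> {0, 1, 2, 3, 4, 5}"
      by auto
    moreover have "(j + k) mod 6 = (j mod 6 + k) mod 6" for k
      by (simp add: mod_simps)
    ultimately show ?thesis
      using cyc pos by (auto simp: p_def q_def Y_cycle_def mult.commute)
  qed
  have "arithmetic_Y_frieze_pattern 3 y"
  proof -
    have I: "{1..3} = {1, 2, 3::nat}" by auto
    have P: "y i j \<in> \<int> \<and> y i j > 0" if "i \<in> {1..3}" for i j
      using that steps[of j] steps[of "j + 4"] by (auto simp: I y_def z_def)
    have R: "y i j * y i (j + 1) = (1 + y (i - 1) (j + 1)) * (1 + y (i + 1) j)"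
      if "i \<in> {1..3}" for i j
    proof -
      consider "i = 1" | "i = 2" | "i = 3" using \<open>i \<in> {1..3}\<close> unfolding I by blast
      then have "z i j * z i (j + 1) = (1 + z (i - 1) (j + 1)) * (1 + z (i + 1) j)"
      proof cases
        case 1
        then show ?thesis using steps[of j] by (simp add: z_def)
      next
        case 2
        then show ?thesis using steps[of j] by (simp add: z_def)
      next
        case 3
        then show ?thesis using steps[of j] by (simp add: z_def add.commute)
      qed
      then have "rat_of_int (z i j * z i (j + 1)) = of_int ((1 + z (i - 1) (j + 1)) * (1 + z (i + 1) j))"
        by (rule arg_cong)
      then show ?thesis
        unfolding y_def of_int_mult of_int_add of_int_1 .
    qed
    have "\<exists>j. y i j \<noteq> 0" if "i \<in> {1..3}" for i
      using P[OF that, of 0] less_irrefl[of "0::rat"] by (intro exI[of _ 0]) auto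
    with P R show ?thesis
      unfolding arithmetic_Y_frieze_pattern_def Y_frieze_pattern_def by (simp add: y_def z_def)
  qed
  moreover have "(of_int p0, of_int q0, of_int p4) = (y 1 0, y 2 0, y 3 0)"
    by (simp add: y_def z_def p_def q_def)
  ultimately show ?thesis by blast
qed

lemma Y_cycle_bound:
  fixes p0 :: int
  assumes cyc: "Y_cycle p0 p1 p2 p3 p4 p5 q0 q1 q2"
    and pos: "p0 > 0" "p1 > 0" "p2 > 0" "p3 > 0" "p4 > 0" "p5 > 0" "q0 > 0" "q1 > 0" "q2 > 0"
  shows "q0 \<le> 73"
proof -
  have pair: "(1 + x) * (1 + z) \<le> 2 * (w + 2)" if "x * z = 1 + w" "x > 0" "z > 0" for x z w :: int
  proof -
    have "0 \<le> (x - 1) * (z - 1)" using that by simp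
    with that show ?thesis by (simp add: algebra_simps)
  qed
  have small: "x + 2 \<le> 3 * x\<^sup>2" if "x > 0" for x :: int
  proof -
    have "0 \<le> (x - 1) * (3 * x + 2)" using that by simp
    then show ?thesis by (simp add: algebra_simps power2_eq_square)
  qed
  \<comment> \<open>The six factors are paired so that each pair belongs to a product
    \<open>1 + q0\<close>, \<open>1 + q1\<close> or \<open>1 + q2\<close>.\<close>
  have "(q0 * q1) * (q1 * q2) * (q2 * q0)
      = ((1 + p0) * (1 + p1)) * ((1 + p4) * (1 + p5)) * ((1 + p2) * (1 + p3))"
    using cyc by (simp add: Y_cycle_def mult_ac)
  also have "\<dots> \<le> (2 * (q0 + 2)) * (2 * (q1 + 2)) * (2 * (q2 + 2))"
    using cyc pos by (intro mult_mono pair) (auto simp: Y_cycle_def)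
  \<comment> \<open>Quadratic bounds in \<open>q1\<close> and \<open>q2\<close> make both cancel,
    leaving a condition on \<open>q0\<close> alone.\<close>
  also have "\<dots> \<le> (2 * (q0 + 2)) * (2 * (3 * q1\<^sup>2)) * (2 * (3 * q2\<^sup>2))"
    using pos by (intro mult_mono small mult_left_mono) auto
  finally have "(q1\<^sup>2 * q2\<^sup>2) * q0\<^sup>2 \<le> (q1\<^sup>2 * q2\<^sup>2) * (72 * (q0 + 2))"
    by (simp add: power2_eq_square algebra_simps)
  then have "q0\<^sup>2 \<le> 72 * (q0 + 2)"
    using pos by (simp add: mult_le_cancel_left)
  then have le: "q0 * (q0 - 72) \<le> 144"
    by (simp add: power2_eq_square algebra_simps)
  show ?thesis
  proof (rule ccontr)
    assume "\<not> q0 \<le> 73"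
    then have "74 * 2 \<le> q0 * (q0 - 72)" by (intro mult_mono) auto
    with le show False by simp
  qed
qed

text \<open>The quotients stand for \<open>p1\<close>, \<open>p3\<close> and \<open>q1\<close>, so
  only necessary divisibilities are tested: \<open>q0\<close> divides two row 2 products,
  \<open>p4\<close> and \<open>p1\<close> divide \<open>1 + q1\<close>. Ranging over lists makes the
  check executable.\<close>

lemma first_diagonal_search:
  "\<forall>q0\<in>set [1..73]. \<forall>p0\<in>set (filter (\<lambda>d. (q0 + 1) mod d = 0) [1..q0 + 1]).
     \<forall>p4\<in>set (filter (\<lambda>d. (1 + (q0 + 1) div d) * (1 + p0) mod q0 = 0 \<and>
         (1 + (q0 + 1) div p0) * (1 + d) mod q0 = 0)
       (filter (\<lambda>d. (q0 + 1) mod d = 0) [1..q0 + 1])).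
     (1 + (1 + (q0 + 1) div p0) * (1 + p4) div q0) mod p4 = 0 \<longrightarrow>
     (1 + (1 + (q0 + 1) div p0) * (1 + p4) div q0) mod ((q0 + 1) div p0) = 0 \<longrightarrow>
     (p0, q0, p4 :: int) \<in> {(1,1,2), (1,2,3), (1,4,5), (2,1,1), (2,3,2), (2,9,5), (3,2,1), (3,8,3),
                 (5,4,1), (5,9,2)}"
  by code_simp

lemma Y_cycle_first_diagonal:
  fixes p0 :: int
  assumes cyc: "Y_cycle p0 p1 p2 p3 p4 p5 q0 q1 q2"
    and pos: "p0 > 0" "p1 > 0" "p2 > 0" "p3 > 0" "p4 > 0" "p5 > 0" "q0 > 0" "q1 > 0" "q2 > 0"
  shows "(p0, q0, p4) \<in> {(1,1,2), (1,2,3), (1,4,5), (2,1,1), (2,3,2), (2,9,5), (3,2,1), (3,8,3),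
                 (5,4,1), (5,9,2)}"
proof -
  note e = cyc[unfolded Y_cycle_def]
  have s: "q0 + 1 = p0 * p1" "q0 + 1 = p3 * p4" using e by auto
  have "p0 dvd q0 + 1" "p4 dvd q0 + 1" by (simp add: s(1), simp add: s(2))
  moreover from this have "p0 \<le> q0 + 1" "p4 \<le> q0 + 1" using pos by (auto intro: zdvd_imp_le)
  moreover have d: "(q0 + 1) div p0 = p1" "(q0 + 1) div p4 = p3"
    by (use s(1) pos in simp) (use s(2) pos in simp)
  moreover have "(1 + p3) * (1 + p0) = q2 * q0" "(1 + p1) * (1 + p4) = q0 * q1"
    using e by auto
  moreover have "(1 + q1) mod p4 = 0" "(1 + q1) mod p1 = 0"
    using e by (metis mult.commute mod_mult_self1_is_0)+
  ultimately show ?thesis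
    using first_diagonal_search[rule_format, of q0 p0 p4] Y_cycle_bound[OF cyc pos] pos by (simp add: d)
qed

theorem theorem2p4:
  fixes a b c :: rat
  shows "(\<exists>y. arithmetic_Y_frieze_pattern 3 y \<and> (a, b, c) = (y 1 0, y 2 0, y 3 0)) \<longleftrightarrow>
    (a, b, c) \<in> {(1,1,2), (1,2,3), (1,4,5), (2,1,1), (2,3,2), (2,9,5), (3,2,1), (3,8,3),
                 (5,4,1), (5,9,2)}"
proof
  assume "\<exists>y. arithmetic_Y_frieze_pattern 3 y \<and> (a, b, c) = (y 1 0, y 2 0, y 3 0)"
  then obtain y where y: "arithmetic_Y_frieze_pattern 3 y"
    and abc: "a = y 1 0" "b = y 2 0" "c = y 3 0"
    by auto
  define z where "z i j = \<lfloor>y i j\<rfloor>" for i j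
  have z: "y i j = of_int (z i j)" "z i j > 0" if "i \<in> {1..3}" for i j
  proof -
    have "y i j \<in> \<int>" "y i j > 0"
      using y that by (auto simp: arithmetic_Y_frieze_pattern_def)
    then show "y i j = of_int (z i j)" "z i j > 0"
      by (auto simp: z_def elim!: Ints_cases)
  qed
  have "Y_cycle (z 1 0) (z 1 1) (z 1 2) (z 3 (-1)) (z 3 0) (z 3 1) (z 2 0) (z 2 1) (z 2 (-1))"
    using Y_cycle_of_arithmetic[OF y] by (simp add: z(1) Y_cycle_of_int)
  then have "(z 1 0, z 2 0, z 3 0) \<in> {(1,1,2), (1,2,3), (1,4,5), (2,1,1), (2,3,2), (2,9,5),
      (3,2,1), (3,8,3), (5,4,1), (5,9,2)}"
    by (rule Y_cycle_first_diagonal) (simp_all add: z(2))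
  then show "(a, b, c) \<in> {(1,1,2), (1,2,3), (1,4,5), (2,1,1), (2,3,2), (2,9,5), (3,2,1), (3,8,3),
                 (5,4,1), (5,9,2)}"
    unfolding abc by (auto simp: z(1))
next
  let ?P = "\<lambda>a b c. \<exists>y. arithmetic_Y_frieze_pattern 3 y \<and> (a, b, c) = (y 1 0, y 2 0, y 3 0)"
  assume "(a, b, c) \<in> {(1,1,2), (1,2,3), (1,4,5), (2,1,1), (2,3,2), (2,9,5), (3,2,1), (3,8,3),
                 (5,4,1), (5,9,2)}"
  \<comment> \<open>In all ten witnesses row 1 has period 3: it repeats a rotation of 1, 2, 5, of 1,
    5, 2, of 1, 3, 3, or the constant 2.\<close>
  moreover have "?P 1 1 2"
    using arithmetic_of_Y_cycle[of 1 2 5 1 2 5 1 9 4] by (simp add: Y_cycle_def)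
  moreover have "?P 1 2 3"
    using arithmetic_of_Y_cycle[of 1 3 3 1 3 3 2 8 2] by (simp add: Y_cycle_def)
  moreover have "?P 1 4 5"
    using arithmetic_of_Y_cycle[of 1 5 2 1 5 2 4 9 1] by (simp add: Y_cycle_def)
  moreover have "?P 2 1 1"
    using arithmetic_of_Y_cycle[of 2 1 5 2 1 5 1 4 9] by (simp add: Y_cycle_def)
  moreover have "?P 2 3 2"
    using arithmetic_of_Y_cycle[of 2 2 2 2 2 2 3 3 3] by (simp add: Y_cycle_def)
  moreover have "?P 2 9 5"
    using arithmetic_of_Y_cycle[of 2 5 1 2 5 1 9 4 1] by (simp add: Y_cycle_def)
  moreover have "?P 3 2 1"
    using arithmetic_of_Y_cycle[of 3 1 3 3 1 3 2 2 8] by (simp add: Y_cycle_def)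
  moreover have "?P 3 8 3"
    using arithmetic_of_Y_cycle[of 3 3 1 3 3 1 8 2 2] by (simp add: Y_cycle_def)
  moreover have "?P 5 4 1"
    using arithmetic_of_Y_cycle[of 5 1 2 5 1 2 4 1 9] by (simp add: Y_cycle_def)
  moreover have "?P 5 9 2"
    using arithmetic_of_Y_cycle[of 5 2 1 5 2 1 9 1 4] by (simp add: Y_cycle_def)
  ultimately show "?P a b c"
    by auto
qed

end
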